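(* Let $n \in \mathbb{N}$ and let $\{A_i\}_{i=1}^n$ be a family of closed subsets of $I^n$ that covers $I^n$. Then there exists $i \in \{1,\dots,n\}$ such that for every closed subset $Z \subset I^n$ satisfying $\dim Z \le i-2$, there exists a connected component of $A_i \setminus Z$ that intersects both $I^n_{i,-}$ and $I^n_{i,+}$.
   Context: $I^n = [0,1]^n$ with the subspace topology from $\mathbb{R}^n$. For $i \in \{1,\dots,n\}$, $I^n_{i,-} = \{z \in I^n : z_i = 0\}$ and $I^n_{i,+} = \{z \in I^n : z_i = 1\}$. $\dim$ denotes the (Lebesgue) covering dimension of a separable metric space, with the convention that $\dim Z \le -1$ if and only if $Z = \emptyset$. *)

theory Defs
  imports "HOL-Analysis.Analysis"
begin

text \<open>Covering dimension: every finite open cover has a finite open refinement in which each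
  point lies in at most \<open>k + 1\<close> members. (For metrizable spaces, and in particular for compact ones,
  allowing arbitrary open covers gives the same notion.) The bound \<open>-1 \<le> k\<close> reflects that the
  dimension of the empty space is \<open>-1\<close>.\<close>

definition covering_dim_le :: "'a topology \<Rightarrow> int \<Rightarrow> bool" where
  "covering_dim_le X k \<longleftrightarrow>
     -1 \<le> k \<and>
     (\<forall>\<U>. finite \<U> \<and> (\<forall>U\<in>\<U>. openin X U) \<and> \<Union>\<U> = topspace X \<longrightarrow>
        (\<exists>\<V>. finite \<V> \<and> (\<forall>V\<in>\<V>. openin X V) \<and> \<Union>\<V> = topspace X \<and>
             (\<forall>V\<in>\<V>. \<exists>U\<in>\<U>. V \<subseteq> U) \<and>
             (\<forall>x\<in>topspace X. int (card {V \<in> \<V>. x \<in> V}) \<le> k + 1)))"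

lemma covering_dim_le_minus_one: "covering_dim_le X (-1) \<longleftrightarrow> topspace X = {}"
proof
  assume "covering_dim_le X (-1)"
  then have "\<exists>\<V>. finite \<V> \<and> (\<forall>V\<in>\<V>. openin X V) \<and> \<Union>\<V> = topspace X \<and>
       (\<forall>V\<in>\<V>. \<exists>U\<in>{topspace X}. V \<subseteq> U) \<and>
       (\<forall>x\<in>topspace X. int (card {V \<in> \<V>. x \<in> V}) \<le> -1 + 1)"
    unfolding covering_dim_le_def by (elim conjE allE[of _ "{topspace X}"] impE) simp_all
  then obtain \<V> where \<V>: "finite \<V>" "\<Union>\<V> = topspace X"
    and *: "\<forall>x\<in>topspace X. int (card {V \<in> \<V>. x \<in> V}) \<le> 0"
    by auto
  from * \<V>(1) have "\<forall>x\<in>topspace X. {V \<in> \<V>. x \<in> V} = {}"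
    by simp
  with \<V>(2) show "topspace X = {}"
    by blast
next
  assume "topspace X = {}"
  then show "covering_dim_le X (-1)"
    unfolding covering_dim_le_def by (auto intro!: exI[of _ "{}"])
qed

text \<open>\<open>\<real>\<^sup>n\<close> is \<open>powertop_real {1..n}\<close>: points are functions on \<open>{1..n}\<close>, extended by
  \<open>undefined\<close> elsewhere.\<close>

definition unit_cube :: "nat \<Rightarrow> (nat \<Rightarrow> real) topology" where
  "unit_cube n = subtopology (powertop_real {1..n}) ({1..n} \<rightarrow>\<^sub>E {0..1})"

definition cube_face_minus :: "nat \<Rightarrow> nat \<Rightarrow> (nat \<Rightarrow> real) set" where
  "cube_face_minus n i = {z \<in> topspace (unit_cube n). z i = 0}"

definition cube_face_plus :: "nat \<Rightarrow> nat \<Rightarrow> (nat \<Rightarrow> real) set" where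
  "cube_face_plus n i = {z \<in> topspace (unit_cube n). z i = 1}"

lemma topspace_unit_cube: "topspace (unit_cube n) = {1..n} \<rightarrow>\<^sub>E {0..1}"
  by (auto simp: unit_cube_def PiE_iff)

end

theory Submission imports Defs begin

text \<open>Suppose that for every \<open>i\<close> some closed \<open>Z i\<close> of dimension at most \<open>i - 2\<close> cuts \<open>A i\<close> so that no
  component of \<open>A i - Z i\<close> joins the two \<open>i\<close>-th faces. Inductively one builds functions
  \<open>f 1, \<dots>, f i\<close> on the cube, with \<open>f j\<close> negative and positive on the two \<open>j\<close>-th faces, that have no
  common zero on \<open>A 1 \<union> \<dots> \<union> A i\<close>. Given \<open>f 1, \<dots>, f i\<close>, the set \<open>Z (i + 1)\<close> has dimension at most
  \<open>i - 1\<close>, so a small perturbation removes all common zeros from it as well; the common zeros in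
  \<open>A (i + 1)\<close> then form a compact subset of \<open>A (i + 1) - Z (i + 1)\<close>, in which components and
  quasicomponents agree, and \<open>f (i + 1)\<close> can be chosen nonzero there. For \<open>i = n\<close> this
  contradicts the Poincare--Miranda theorem, since the \<open>A i\<close> cover the cube.\<close>

section \<open>The cube as a compact metric space\<close>

lemma tendsto_fun_iff:
  fixes f :: "'c \<Rightarrow> 'a \<Rightarrow> 'b::topological_space"
  shows "(f \<longlongrightarrow> l) F \<longleftrightarrow> (\<forall>k. ((\<lambda>m. f m k) \<longlongrightarrow> l k) F)"
proof -
  have "(f \<longlongrightarrow> l) F \<longleftrightarrow> limitin (product_topology (\<lambda>i::'a. euclidean :: 'b topology) UNIV) f l F"
    by (simp add: euclidean_product_topology)
  then show ?thesis
    by (simp add: limitin_componentwise)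
qed

text \<open>Moves the cube into the topology of the type \<open>nat \<Rightarrow> real\<close>, so
  that metric and type-class results apply. Coordinates outside \<open>{1..n}\<close> are constantly
  \<open>undefined\<close> on the cube, so the larger index set adds no open sets.\<close>

lemma unit_cube_eq: "unit_cube n = top_of_set ({1..n} \<rightarrow>\<^sub>E {0..1})"
proof -
  let ?K = "{1..n} \<rightarrow>\<^sub>E {0..1::real}"
  have top: "topspace (unit_cube n) = topspace (top_of_set ?K)"
    by (simp add: topspace_unit_cube)
  have "continuous_map (unit_cube n) (powertop_real UNIV) id"
  proof (rule continuous_map_coordinatewise_then_product)
    fix i :: nat
    show "continuous_map (unit_cube n) euclideanreal (\<lambda>x. id x i)"
    proof (cases "i \<in> {1..n}")
      case True
      then show ?thesis
        unfolding unit_cube_def id_def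
        by (intro continuous_map_from_subtopology continuous_map_product_coordinates)
    next
      case False
      then have "\<And>x. x \<in> topspace (unit_cube n) \<Longrightarrow> undefined = id x i"
        by (auto simp: topspace_unit_cube PiE_def extensional_def)
      then show ?thesis
        by (intro continuous_map_eq[OF continuous_map_const[THEN iffD2]]) auto
    qed
  qed auto
  then have "continuous_map (unit_cube n) (top_of_set ?K) id"
    using top by (auto simp: continuous_map_in_subtopology euclidean_product_topology)
  moreover have "continuous_map (top_of_set ?K) (powertop_real {1..n}) id"
  proof (rule continuous_map_coordinatewise_then_product)
    fix i :: nat
    show "continuous_map (top_of_set ?K) euclideanreal (\<lambda>x. id x i)"
      using continuous_on_subset[OF continuous_on_product_coordinates[of i]] by auto
  qed (auto simp: PiE_def extensional_def)
  then have "continuous_map (top_of_set ?K) (unit_cube n) id"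
    unfolding unit_cube_def by (auto simp: continuous_map_in_subtopology)
  ultimately show ?thesis
    unfolding topology_eq
    using topology_finer_continuous_id[OF top] topology_finer_continuous_id[OF top[symmetric]]
    by blast
qed

lemma compact_unit_cube: "compact ({1..n::nat} \<rightarrow>\<^sub>E {0..1::real})"
proof -
  have "compactin (powertop_real {1..n}) ({1..n} \<rightarrow>\<^sub>E {0..1})"
    by (subst compactin_PiE) auto
  then have "compact_space (unit_cube n)"
    unfolding unit_cube_def by (rule compact_space_subtopology)
  then show ?thesis
    by (simp add: unit_cube_eq compact_space_subtopology compact_space_def compactin_subtopology)
qed

lemma compact_pos_lower_bound:
  fixes f :: "'a::topological_space \<Rightarrow> real"
  assumes "compact S" "continuous_on S f" "\<And>x. x \<in> S \<Longrightarrow> 0 < f x"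
  shows "\<exists>c>0. \<forall>x\<in>S. c \<le> f x"
proof (cases "S = {}")
  case True
  then show ?thesis by (auto simp: gt_ex)
next
  case False
  then obtain x where "x \<in> S" "\<forall>y\<in>S. f x \<le> f y"
    using continuous_attains_inf assms by blast
  then show ?thesis using assms(3) by blast
qed

section \<open>The Poincare--Miranda theorem\<close>

text \<open>Kuhn's combinatorial lemma is applied to ever finer grids labelled by the signs of the
  \<open>f j\<close>. It yields small cells on which every \<open>f j\<close> takes both signs, and
  a limit of such cells is a common zero.\<close>

lemma poincare_miranda:
  fixes f :: "nat \<Rightarrow> (nat \<Rightarrow> real) \<Rightarrow> real"
  defines "K \<equiv> \<lambda>n::nat. {1..n} \<rightarrow>\<^sub>E {0..1::real}"
  assumes cont: "\<And>j. j \<in> {1..n} \<Longrightarrow> continuous_on (K n) (f j)"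
    and neg: "\<And>j z. \<lbrakk>j \<in> {1..n}; z \<in> K n; z j = 0\<rbrakk> \<Longrightarrow> f j z < 0"
    and pos: "\<And>j z. \<lbrakk>j \<in> {1..n}; z \<in> K n; z j = 1\<rbrakk> \<Longrightarrow> 0 < f j z"
  obtains z where "z \<in> K n" "\<And>j. j \<in> {1..n} \<Longrightarrow> f j z = 0"
proof -
  \<comment> \<open>\<open>z\<close> is the corner of a grid cell of mesh
    \<open>1 / (m + 1)\<close>; \<open>a j\<close> and \<open>b j\<close> are vertices of that cell
    at which \<open>f j\<close> has opposite signs.\<close>
  define G where "G m z a b \<longleftrightarrow> z \<in> K n \<and>
    (\<forall>j\<in>{1..n}. a j \<in> K n \<and> b j \<in> K n \<and> f j (a j) < 0 \<and> 0 \<le> f j (b j) \<and>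
      (\<forall>k. \<bar>a j k - z k\<bar> \<le> inverse (real (Suc m))) \<and> (\<forall>k. \<bar>b j k - z k\<bar> \<le> inverse (real (Suc m))))"
    for m :: nat and z :: "nat \<Rightarrow> real" and a b :: "nat \<Rightarrow> nat \<Rightarrow> real"
  have "\<exists>z a b. G m z a b" for m
  proof -
    define p where "p = Suc m"
    \<comment> \<open>Kuhn's lemma numbers coordinates from 0 and the cube from 1, hence the shifts
      by one here and in \<open>lab\<close>.\<close>
    define pt where "pt x = (\<lambda>k. if k \<in> {1..n} then real (x (k - 1)) / real p else undefined)"
      for x :: "nat \<Rightarrow> nat"
    define lab where "lab x i = (if f (Suc i) (pt x) < 0 then 0 else 1::nat)" for x i
    have pt_K: "pt x \<in> K n" if "\<forall>i<n. x i \<le> p" for x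
    proof -
      have "real (x (k - 1)) / real p \<in> {0..1}" if "k \<in> {1..n}" for k
      proof -
        have "k - 1 < n" using that by auto
        then have "x (k - 1) \<le> p" using \<open>\<forall>i<n. x i \<le> p\<close> by blast
        then show ?thesis by (simp add: p_def)
      qed
      then show ?thesis by (simp add: pt_def K_def PiE_iff extensional_def)
    qed
    have near: "\<bar>pt x k - pt q k\<bar> \<le> inverse (real (Suc m))"
      if "\<forall>j<n. q j \<le> x j \<and> x j \<le> q j + 1" for x q k
    proof (cases "k \<in> {1..n}")
      case True
      then have "k - 1 < n" by auto
      with that have *: "q (k - 1) \<le> x (k - 1)" "x (k - 1) \<le> q (k - 1) + 1" by auto
      have "pt x k - pt q k = (real (x (k-1)) - real (q (k-1))) / real p"
        using True by (simp add: pt_def diff_divide_distrib)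
      moreover have "\<bar>real (x (k-1)) - real (q (k-1))\<bar> \<le> 1"
        using * by linarith
      ultimately show ?thesis
        by (simp add: p_def divide_inverse abs_mult mult_left_le_one_le)
    next
      case False
      then have "pt x k = pt q k" by (auto simp: pt_def)
      then show ?thesis by simp
    qed
    have 0: "\<forall>x. (\<forall>i<n. x i \<le> p) \<longrightarrow> (\<forall>i<n. lab x i = (0::nat) \<or> lab x i = 1)"
      by (simp add: lab_def)
    have 1: "\<forall>x. (\<forall>i<n. x i \<le> p) \<longrightarrow> (\<forall>i<n. x i = 0 \<longrightarrow> lab x i = 0)"
    proof (intro allI impI)
      fix x i assume x: "\<forall>i<n. x i \<le> p" "i < n" "x i = 0"
      then have "f (Suc i) (pt x) < 0"
        by (intro neg pt_K) (auto simp: pt_def)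
      then show "lab x i = 0" by (simp add: lab_def)
    qed
    have 2: "\<forall>x. (\<forall>i<n. x i \<le> p) \<longrightarrow> (\<forall>i<n. x i = p \<longrightarrow> lab x i = 1)"
    proof (intro allI impI)
      fix x i assume x: "\<forall>i<n. x i \<le> p" "i < n" "x i = p"
      then have "0 < f (Suc i) (pt x)"
        by (intro pos pt_K) (auto simp: pt_def p_def)
      then show "lab x i = 1" by (simp add: lab_def)
    qed
    have "0 < p" by (simp add: p_def)
    from kuhn_lemma[OF this 0 1 2] obtain q where q: "\<forall>i<n. q i < p"
      "\<forall>i<n. \<exists>r s. (\<forall>j<n. q j \<le> r j \<and> r j \<le> q j + 1) \<and> (\<forall>j<n. q j \<le> s j \<and> s j \<le> q j + 1) \<and> lab r i \<noteq> lab s i"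
      by blast
    have "\<exists>a b. a \<in> K n \<and> b \<in> K n \<and> f j a < 0 \<and> 0 \<le> f j b \<and>
      (\<forall>k. \<bar>a k - pt q k\<bar> \<le> inverse (real (Suc m))) \<and> (\<forall>k. \<bar>b k - pt q k\<bar> \<le> inverse (real (Suc m)))"
      if j: "j \<in> {1..n}" for j
    proof -
      have "j - 1 < n" using j by auto
      with q(2) obtain r s where r: "\<forall>j<n. q j \<le> r j \<and> r j \<le> q j + 1"
        and s: "\<forall>j<n. q j \<le> s j \<and> s j \<le> q j + 1" and "lab r (j-1) \<noteq> lab s (j-1)"
        by blast
      moreover have "Suc (j - 1) = j" using j by auto
      ultimately have "f j (pt r) < 0 \<and> 0 \<le> f j (pt s) \<or> f j (pt s) < 0 \<and> 0 \<le> f j (pt r)"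
        by (auto simp: lab_def split: if_splits)
      moreover have "pt r \<in> K n" "pt s \<in> K n"
        using r s q(1) by (auto intro!: pt_K) (meson Suc_leI le_trans)+
      ultimately show ?thesis
        using near[OF r] near[OF s] by blast
    qed
    then obtain a b where "\<forall>j\<in>{1..n}. a j \<in> K n \<and> b j \<in> K n \<and> f j (a j) < 0 \<and> 0 \<le> f j (b j) \<and>
      (\<forall>k. \<bar>a j k - pt q k\<bar> \<le> inverse (real (Suc m))) \<and> (\<forall>k. \<bar>b j k - pt q k\<bar> \<le> inverse (real (Suc m)))"
      by metis
    moreover have "pt q \<in> K n"
      using q(1) by (auto intro!: pt_K)
    ultimately show ?thesis unfolding G_def by blast
  qed
  then obtain z a b where "\<And>m. G m (z m) (a m) (b m)"
    by metis
  then have z: "\<And>m. z m \<in> K n"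
    and a: "\<And>m j. j \<in> {1..n} \<Longrightarrow> a m j \<in> K n" "\<And>m j. j \<in> {1..n} \<Longrightarrow> f j (a m j) < 0"
      "\<And>m j k. j \<in> {1..n} \<Longrightarrow> \<bar>a m j k - z m k\<bar> \<le> inverse (real (Suc m))"
    and b: "\<And>m j. j \<in> {1..n} \<Longrightarrow> b m j \<in> K n" "\<And>m j. j \<in> {1..n} \<Longrightarrow> 0 \<le> f j (b m j)"
      "\<And>m j k. j \<in> {1..n} \<Longrightarrow> \<bar>b m j k - z m k\<bar> \<le> inverse (real (Suc m))"
    unfolding G_def by blast+
  obtain l h where l: "l \<in> K n" and h: "strict_mono (h :: nat \<Rightarrow> nat)" and lim: "(z \<circ> h) \<longlonglongrightarrow> l"
    using compact_unit_cube[of n, unfolded compact_eq_seq_compact_metric] z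
    unfolding K_def by (metis seq_compactE)
  have inv: "(\<lambda>m. inverse (real (Suc (h m)))) \<longlonglongrightarrow> 0"
    using LIMSEQ_subseq_LIMSEQ[OF LIMSEQ_inverse_real_of_nat h] by (simp add: o_def)
  \<comment> \<open>The cells shrink to a point along the subsequence \<open>h\<close>, so any
    choice of cell vertices has the same limit \<open>l\<close> as the corners.\<close>
  have conv: "(\<lambda>m. f j (w (h m))) \<longlonglongrightarrow> f j l" if "j \<in> {1..n}" "\<And>m. w m \<in> K n"
      "\<And>m k. \<bar>w m k - z m k\<bar> \<le> inverse (real (Suc m))" for j and w :: "nat \<Rightarrow> nat \<Rightarrow> real"
  proof -
    have "(\<lambda>m. w (h m) k) \<longlonglongrightarrow> l k" for k
    proof -
      have "(\<lambda>m. w (h m) k - z (h m) k) \<longlonglongrightarrow> 0"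
        using that(3) by (intro Lim_null_comparison[OF _ inv] always_eventually) simp
      moreover have "(\<lambda>m. z (h m) k) \<longlonglongrightarrow> l k"
        using lim by (simp add: tendsto_fun_iff)
      ultimately show ?thesis
        using tendsto_add by fastforce
    qed
    then have "(\<lambda>m. w (h m)) \<longlonglongrightarrow> l"
      by (simp add: tendsto_fun_iff)
    then show ?thesis
      by (rule continuous_on_tendsto_compose[OF cont[OF that(1)]]) (use l that(2) in auto)
  qed
  have "f j l = 0" if j: "j \<in> {1..n}" for j
  proof (rule antisym)
    have "(\<lambda>m. f j (a (h m) j)) \<longlonglongrightarrow> f j l"
      using conv[of j "\<lambda>m. a m j"] a j by blast
    then show "f j l \<le> 0"
      using a(2)[OF j] by (intro LIMSEQ_le_const2) (auto intro: less_imp_le)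
    have "(\<lambda>m. f j (b (h m) j)) \<longlonglongrightarrow> f j l"
      using conv[of j "\<lambda>m. b m j"] b j by blast
    then show "0 \<le> f j l"
      using b(2)[OF j] by (intro LIMSEQ_le_const) auto
  qed
  with l show thesis using that by blast
qed

section \<open>Unstable values on spaces of small dimension\<close>

text \<open>A cover \<open>\<V>\<close> of order at most \<open>i\<close> by small sets leaves, at every point, one of \<open>i\<close> disjoint
  level intervals of the functions \<open>phi V\<close> free of values. On the set \<open>M j\<close> where the \<open>j\<close>-th
  interval is free, the family of those \<open>V\<close> with \<open>phi V\<close> above the interval is locally constant, so
  \<open>f j\<close> can be replaced there by a locally constant nonzero function.\<close>

lemma zero_avoiding_perturbation:
  fixes f :: "nat \<Rightarrow> 'a::{metric_space,second_countable_topology} \<Rightarrow> real"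
  assumes Z: "compact Z" "Z \<subseteq> K" and dim: "covering_dim_le (top_of_set Z) (int i - 1)"
    and f: "\<And>j. j \<in> {1..i} \<Longrightarrow> continuous_on K (f j)" and e: "0 < e"
  obtains g where "\<And>j. j \<in> {1..i} \<Longrightarrow> continuous_on K (g j)"
    "\<And>j x. \<lbrakk>j \<in> {1..i}; x \<in> K\<rbrakk> \<Longrightarrow> \<bar>g j x - f j x\<bar> \<le> e"
    "\<And>x. x \<in> Z \<Longrightarrow> \<exists>j\<in>{1..i}. g j x \<noteq> 0"
proof (cases "Z = {}")
  case True
  then show ?thesis using that[of f] f e by auto
next
  case False
  \<comment> \<open>Sets on which every \<open>f j\<close> stays within \<open>e/2\<close> of its
    value at \<open>p\<close>. The intersection with the whole space matters for
    \<open>i = 0\<close>, where the indexed intersection is \<open>UNIV\<close>.\<close>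
  define U where "U p = (\<Inter>j\<in>{1..i}. Z \<inter> f j -` ball (f j p) (e/2)) \<inter> topspace (top_of_set Z)" for p
  have opU: "openin (top_of_set Z) (U p)" for p
    unfolding U_def
  proof (intro openin_INT)
    fix j assume "j \<in> {1..i}"
    then have "continuous_on Z (f j)" using f Z continuous_on_subset by blast
    then show "openin (top_of_set Z) (Z \<inter> f j -` ball (f j p) (e/2))"
      by (intro continuous_openin_preimage_gen) auto
  qed auto
  have "Z \<subseteq> \<Union>(U ` Z)" using e by (auto simp: U_def)
  with opU Z(1) obtain D where D: "D \<subseteq> U ` Z" "finite D" "Z \<subseteq> \<Union>D"
    unfolding compact_eq_openin_cover by (metis (no_types, lifting) image_iff)
  have "\<forall>u\<in>D. openin (top_of_set Z) u" using D opU by auto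
  moreover have "U p \<subseteq> Z" for p by (simp add: U_def)
  then have "\<Union>D = topspace (top_of_set Z)" using D by fastforce
  ultimately have "\<exists>\<V>. finite \<V> \<and> (\<forall>V\<in>\<V>. openin (top_of_set Z) V) \<and> \<Union>\<V> = topspace (top_of_set Z) \<and>
      (\<forall>V\<in>\<V>. \<exists>u\<in>D. V \<subseteq> u) \<and>
      (\<forall>x\<in>topspace (top_of_set Z). int (card {V \<in> \<V>. x \<in> V}) \<le> int i - 1 + 1)"
    using dim D(2) unfolding covering_dim_le_def by blast
  then obtain \<V> where V: "finite \<V>" "\<And>V. V \<in> \<V> \<Longrightarrow> openin (top_of_set Z) V" "\<Union>\<V> = Z"
    and ref: "\<And>V. V \<in> \<V> \<Longrightarrow> \<exists>u\<in>D. V \<subseteq> u"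
    and ord: "\<And>x. x \<in> Z \<Longrightarrow> card {V \<in> \<V>. x \<in> V} \<le> i"
  proof (elim exE conjE)
    fix \<V> assume "finite \<V>" "\<forall>V\<in>\<V>. openin (top_of_set Z) V" "\<Union>\<V> = topspace (top_of_set Z)"
      "\<forall>V\<in>\<V>. \<exists>u\<in>D. V \<subseteq> u"
      "\<forall>x\<in>topspace (top_of_set Z). int (card {V \<in> \<V>. x \<in> V}) \<le> int i - 1 + 1"
    then show thesis by (intro that[of \<V>]) auto
  qed
  \<comment> \<open>A nonzero constant that can stand for \<open>f j\<close> on \<open>V\<close>:
    the value \<open>f j p\<close> if that is nonzero, and otherwise \<open>e/2\<close>, which is
    still within \<open>e\<close>.\<close>
  have "\<exists>r. r \<noteq> 0 \<and> (\<forall>x\<in>V. \<bar>r - f j x\<bar> \<le> e)" if "V \<in> \<V>" "j \<in> {1..i}" for V j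
  proof -
    obtain u where "u \<in> D" "V \<subseteq> u" using ref[OF \<open>V \<in> \<V>\<close>] by blast
    then obtain p where p: "V \<subseteq> U p" using D(1) by blast
    have *: "\<bar>f j p - f j x\<bar> < e/2" if "x \<in> V" for x
      using p that \<open>j \<in> {1..i}\<close> by (force simp: U_def dist_real_def)
    show ?thesis
    proof (cases "f j p = 0")
      case True
      have "\<bar>e/2 - f j x\<bar> \<le> e" if "x \<in> V" for x
        using *[OF that] True by linarith
      then show ?thesis using e by (intro exI[of _ "e/2"]) auto
    next
      case False
      have "\<bar>f j p - f j x\<bar> \<le> e" if "x \<in> V" for x
        using *[OF that] e by linarith
      then show ?thesis using False by blast
    qed
  qed
  then obtain r where r0: "\<And>V j. \<lbrakk>V \<in> \<V>; j \<in> {1..i}\<rbrakk> \<Longrightarrow> r V j \<noteq> 0"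
    and re: "\<And>V j x. \<lbrakk>V \<in> \<V>; j \<in> {1..i}; x \<in> V\<rbrakk> \<Longrightarrow> \<bar>r V j - f j x\<bar> \<le> e"
    by metis

  \<comment> \<open>Distance to the complement of \<open>V\<close> in \<open>Z\<close>. The case
    \<open>V = Z\<close> is separate because \<open>infdist\<close> to the empty set is 0, while
    positivity on \<open>V\<close> is needed.\<close>
  define phi where "phi V x = (if V = Z then 1 else infdist x (Z - V))" for V x
  have cphi: "continuous_on S (phi V)" for S V
    unfolding phi_def by (cases "V = Z") (auto intro!: continuous_intros)
  have phi0: "0 \<le> phi V x" for V x
    by (simp add: phi_def infdist_nonneg)
  have phi_pos: "0 < phi V x \<longleftrightarrow> x \<in> V" if "V \<in> \<V>" "x \<in> Z" for V x
  proof (cases "V = Z")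
    case False
    have "closedin (top_of_set Z) (Z - V)"
      using V(2)[OF that(1)] by (simp add: closedin_diff)
    then have cl: "closed (Z - V)"
      using Z(1) closedin_closed_trans compact_imp_closed by blast
    have "V \<subseteq> Z" using V(3) that(1) by auto
    then have "Z - V \<noteq> {}" using False by blast
    then show ?thesis
      using infdist_pos_not_in_closed[OF cl \<open>Z - V \<noteq> {}\<close>, of x]
        infdist_zero[of x "Z - V"] that False by (cases "x \<in> V") (auto simp: phi_def)
  qed (use that in \<open>auto simp: phi_def\<close>)

  have "0 < (\<Sum>V\<in>\<V>. phi V x)" if x: "x \<in> Z" for x
  proof -
    obtain W where "W \<in> \<V>" "x \<in> W" using V(3) x by blast
    then show ?thesis using phi_pos[of W x] x by (intro sum_pos2[OF V(1), of W] phi0) auto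
  qed
  moreover have "continuous_on Z (\<lambda>x. \<Sum>V\<in>\<V>. phi V x)"
    by (intro continuous_on_sum cphi)
  ultimately obtain c where c: "0 < c" "\<And>x. x \<in> Z \<Longrightarrow> c \<le> (\<Sum>V\<in>\<V>. phi V x)"
    using compact_pos_lower_bound[OF Z(1), of "\<lambda>x. \<Sum>V\<in>\<V>. phi V x"] by blast
  have "\<V> \<noteq> {}" using V(3) False by auto
  then have cardV: "0 < card \<V>" using V(1) by (simp add: card_gt_0_iff)
  have "0 < i"
  proof -
    obtain x where x: "x \<in> Z" using False by auto
    then have "{V \<in> \<V>. x \<in> V} \<noteq> {}" using V(3) by auto
    then have "0 < card {V \<in> \<V>. x \<in> V}" using V(1) by (simp add: card_gt_0_iff)
    with ord[OF x] show ?thesis by linarith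
  qed
  \<comment> \<open>Chosen so that \<open>real i * d\<close> is \<open>c\<close> divided by
    \<open>card \<V>\<close>: at each point of \<open>Z\<close> some \<open>phi V\<close> reaches
    this average, hence lies above all the intervals from \<open>(j - 1) * d\<close> to
    \<open>j * d\<close> with \<open>j\<close> in \<open>{1..i}\<close>.\<close>
  define d where "d = c / (real (card \<V>) * real i)"
  have d: "0 < d" using c(1) cardV \<open>0 < i\<close> by (simp add: d_def)
  have big: "\<exists>V\<in>\<V>. real i * d \<le> phi V x" if "x \<in> Z" for x
  proof (rule ccontr)
    assume "\<not> ?thesis"
    then have "(\<Sum>V\<in>\<V>. phi V x) < (\<Sum>V\<in>\<V>. real i * d)"
      using V(1) \<open>\<V> \<noteq> {}\<close> by (intro sum_strict_mono) auto
    also have "\<dots> = c" using cardV \<open>0 < i\<close> by (simp add: d_def)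
    finally show False using c(2)[OF that] by linarith
  qed

  define T where "T j x = {V \<in> \<V>. real j * d \<le> phi V x}" for j x
  \<comment> \<open>On this closed set the members of \<open>\<T>\<close> are at or above the top of
    the \<open>j\<close>-th interval and all others at or below its bottom. The gap forces
    \<open>T j x = \<T>\<close>.\<close>
  define KT where "KT j \<T> = Z \<inter> (\<Inter>V\<in>\<T>. {x. real j * d \<le> phi V x}) \<inter>
     (\<Inter>V\<in>\<V>-\<T>. {x. phi V x \<le> (real j - 1) * d})" for j \<T>
  define M where "M j = (\<Union>\<T>\<in>Pow \<V> - {{}}. KT j \<T>)" for j
  \<comment> \<open>The chosen \<open>V\<close> depends only on \<open>T j x\<close>, so
    \<open>R j\<close> is constant on each of the finitely many closed pieces of
    \<open>M j\<close>.\<close>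
  define R where "R j x = r (SOME V. V \<in> T j x) j" for j x
  have clKT: "closed (KT j \<T>)" for j \<T>
    unfolding KT_def using compact_imp_closed[OF Z(1)]
    by (intro closed_Int closed_INT ballI closed_Collect_le cphi continuous_on_const) auto
  have clM: "closed (M j)" for j
    unfolding M_def using V(1) clKT by (intro closed_UN) auto
  have MZ: "M j \<subseteq> Z" for j by (auto simp: M_def KT_def)
  have TKT: "T j x = \<T>" if "x \<in> KT j \<T>" "\<T> \<subseteq> \<V>" for j \<T> x
  proof -
    have "(real j - 1) * d < real j * d" using d by simp
    then have "V \<notin> T j x" if "V \<in> \<V> - \<T>" for V
      using \<open>x \<in> KT j \<T>\<close> that by (force simp: T_def KT_def)
    then show ?thesis using that by (auto simp: T_def KT_def)
  qed
  have cR: "continuous_on (M j) (R j)" for j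
    unfolding M_def
  proof (rule continuous_on_closed_Union)
    fix \<T> assume "\<T> \<in> Pow \<V> - {{}}"
    then have "R j x = r (SOME V. V \<in> \<T>) j" if "x \<in> KT j \<T>" for x
      using TKT that by (auto simp: R_def)
    then show "continuous_on (KT j \<T>) (R j)"
      by (intro continuous_on_eq[OF continuous_on_const[of _ "r (SOME V. V \<in> \<T>) j"]]) auto
  qed (use V(1) clKT in auto)
  have RM: "R j x \<noteq> 0 \<and> \<bar>R j x - f j x\<bar> \<le> e" if j: "j \<in> {1..i}" and x: "x \<in> M j" for j x
  proof -
    obtain \<T> where \<T>: "\<T> \<subseteq> \<V>" "\<T> \<noteq> {}" "x \<in> KT j \<T>" using x by (auto simp: M_def)
    define W where "W = (SOME V. V \<in> T j x)"
    have W: "W \<in> T j x" unfolding W_def TKT[OF \<T>(3,1)] using \<T>(2) by (simp add: some_in_eq)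
    have "0 < real j * d" using d j by simp
    with W have "W \<in> \<V>" "x \<in> W" using phi_pos[of W x] x MZ by (auto simp: T_def)
    then show ?thesis using r0 re j by (simp add: R_def W_def[symmetric])
  qed
  \<comment> \<open>Pigeonhole: if each of the \<open>i\<close> open intervals contained a value
    \<open>phi (v j) x\<close>, the \<open>v j\<close> would be \<open>i\<close> distinct members
    containing \<open>x\<close>, all different from \<open>V0\<close>, which lies above every
    interval. That makes \<open>i + 1\<close> members, against \<open>ord\<close>.\<close>
  have cover: "\<exists>j\<in>{1..i}. x \<in> M j" if x: "x \<in> Z" for x
  proof (rule ccontr)
    assume none: "\<not> ?thesis"
    obtain V0 where V0: "V0 \<in> \<V>" "real i * d \<le> phi V0 x" using big[OF x] by auto
    have V0j: "real j * d \<le> phi V0 x" if "j \<in> {1..i}" for j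
      using V0(2) d that by (smt (verit) atLeastAtMost_iff mult_right_mono of_nat_mono)
    have "\<exists>V\<in>\<V>. (real j - 1) * d < phi V x \<and> phi V x < real j * d" if j: "j \<in> {1..i}" for j
    proof (rule ccontr)
      assume "\<not> ?thesis"
      then have "x \<in> KT j (T j x)"
        using x by (force simp: KT_def T_def)
      moreover have "T j x \<noteq> {}" using V0 V0j[OF j] by (auto simp: T_def)
      moreover have "T j x \<subseteq> \<V>" by (auto simp: T_def)
      ultimately have "x \<in> M j" by (auto simp: M_def)
      with none j show False by blast
    qed
    then obtain v where v: "\<And>j. j \<in> {1..i} \<Longrightarrow> v j \<in> \<V>"
      "\<And>j. j \<in> {1..i} \<Longrightarrow> (real j - 1) * d < phi (v j) x"
      "\<And>j. j \<in> {1..i} \<Longrightarrow> phi (v j) x < real j * d"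
      by metis
    have "inj_on v {1..i}"
    proof (rule linorder_inj_onI')
      fix j k assume jk: "j \<in> {1..i}" "k \<in> {1..i}" "j < k"
      then have "real j * d \<le> (real k - 1) * d" using d by (intro mult_right_mono) auto
      then show "v j \<noteq> v k" using v(2)[OF jk(2)] v(3)[OF jk(1)] by force
    qed
    moreover have "v ` {1..i} \<subseteq> {V \<in> \<V>. x \<in> V} - {V0}"
    proof
      fix W assume "W \<in> v ` {1..i}"
      then obtain j where j: "j \<in> {1..i}" "W = v j" by auto
      have "0 \<le> (real j - 1) * d" using j(1) d by simp
      then have "0 < phi W x" using v(2)[OF j(1)] unfolding j(2) by linarith
      moreover have "W \<noteq> V0" using v(3)[OF j(1)] V0j[OF j(1)] j(2) by auto
      ultimately show "W \<in> {V \<in> \<V>. x \<in> V} - {V0}"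
        using v(1)[OF j(1)] j(2) phi_pos x by auto
    qed
    ultimately have "i \<le> card ({V \<in> \<V>. x \<in> V} - {V0})"
      using V(1) card_inj_on_le[of v "{1..i}"] by auto
    moreover have "0 < phi V0 x"
      using V0(2) d \<open>0 < i\<close> by (smt (verit) mult_pos_pos of_nat_0_less_iff)
    then have "V0 \<in> {V \<in> \<V>. x \<in> V}" using V0 phi_pos x by auto
    then have "card ({V \<in> \<V>. x \<in> V} - {V0}) < card {V \<in> \<V>. x \<in> V}"
      using V(1) by (intro card_Diff1_less) auto
    ultimately show False using ord[OF x] by linarith
  qed
  \<comment> \<open>Tietze is applied to the difference \<open>R j - f j\<close> rather than to
    \<open>R j\<close>, so that the bound \<open>e\<close> persists on all of
    \<open>K\<close>.\<close>
  have "\<exists>h. continuous_on K h \<and> (\<forall>x\<in>M j. h x = R j x - f j x) \<and> (\<forall>x\<in>K. \<bar>h x\<bar> \<le> e)"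
    if j: "j \<in> {1..i}" for j
  proof -
    have "continuous_on (M j) (\<lambda>x. R j x - f j x)"
      using MZ[of j] Z(2) by (intro continuous_on_diff cR continuous_on_subset[OF f[OF j]]) auto
    moreover have "closedin (top_of_set K) (M j)"
      using clM MZ Z(2) by (intro closed_subset) auto
    ultimately obtain h where "continuous_on K h" "\<And>x. x \<in> M j \<Longrightarrow> h x = R j x - f j x"
      "\<And>x. x \<in> K \<Longrightarrow> norm (h x) \<le> e"
      using Tietze[of "M j" "\<lambda>x. R j x - f j x" K e] RM[OF j] e by auto
    then show ?thesis by auto
  qed
  then obtain h where h: "\<And>j. j \<in> {1..i} \<Longrightarrow> continuous_on K (h j)"
    "\<And>j x. \<lbrakk>j \<in> {1..i}; x \<in> M j\<rbrakk> \<Longrightarrow> h j x = R j x - f j x"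
    "\<And>j x. \<lbrakk>j \<in> {1..i}; x \<in> K\<rbrakk> \<Longrightarrow> \<bar>h j x\<bar> \<le> e"
    by metis
  show ?thesis
  proof (rule that[of "\<lambda>j x. f j x + h j x"])
    fix x assume "x \<in> Z"
    then obtain j where j: "j \<in> {1..i}" "x \<in> M j" using cover by blast
    then show "\<exists>j\<in>{1..i}. f j x + h j x \<noteq> 0"
      using h(2) RM by (intro bexI[of _ j]) auto
  qed (use f h in \<open>auto intro: continuous_on_add\<close>)
qed

section \<open>Separating functions\<close>

text \<open>In a compact Hausdorff space, two closed sets that no connected set joins are separated
  by a clopen set \<open>U\<close>. The function equal to -1 on \<open>P \<union> U\<close> and 1 on
  \<open>Q \<union> (A - U)\<close> is then continuous on a closed set and extends by
  Tietze.\<close>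

lemma separating_function:
  fixes A P Q K :: "'a::{metric_space,second_countable_topology} set"
  assumes A: "compact A" and P: "closed P" and Q: "closed Q" and disj: "P \<inter> Q = {}"
    and sub: "A \<subseteq> K" "P \<subseteq> K" "Q \<subseteq> K"
    and con: "\<And>C. \<lbrakk>connected C; C \<subseteq> A\<rbrakk> \<Longrightarrow> C \<inter> P = {} \<or> C \<inter> Q = {}"
  obtains f :: "'a \<Rightarrow> real" where "continuous_on K f" "\<And>x. x \<in> P \<Longrightarrow> f x = -1"
    "\<And>x. x \<in> Q \<Longrightarrow> f x = 1" "\<And>x. x \<in> A \<Longrightarrow> f x \<noteq> 0"
proof -
  have "separated_between (top_of_set A) (A \<inter> P) (A \<inter> Q)"
  proof (rule cut_wire_fence_theorem)
    show "compact_space (top_of_set A)" using A by (simp add: compact_space_subtopology)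
    show "Hausdorff_space (top_of_set A)" by (simp add: Hausdorff_space_subtopology)
    show "closedin (top_of_set A) (A \<inter> P)" "closedin (top_of_set A) (A \<inter> Q)"
      using P Q by (auto simp: closedin_closed_Int)
    show "disjnt C (A \<inter> P) \<or> disjnt C (A \<inter> Q)" if "connectedin (top_of_set A) C" for C
      using con[of C] that by (auto simp: connectedin_subtopology disjnt_def)
  qed
  then obtain U where U: "closedin (top_of_set A) U" "openin (top_of_set A) U" "A \<inter> P \<subseteq> U" "A \<inter> Q \<subseteq> A - U"
    by (auto simp: separated_between)
  have "closedin (top_of_set A) (A - U)" using U(2) by (simp add: closedin_diff)
  then have "closed U" "closed (A - U)"
    using U(1) A closedin_closed_trans compact_imp_closed by blast+
  then have cl: "closed (P \<union> U)" "closed (Q \<union> (A - U))" using P Q by auto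
  have UA: "U \<subseteq> A" using U(1) closedin_subset by fastforce
  then have dis: "(P \<union> U) \<inter> (Q \<union> (A - U)) = {}" using U disj by blast
  define s where "s x = (if x \<in> P \<union> U then -1 else 1::real)" for x
  have "continuous_on ((P \<union> U) \<union> (Q \<union> (A - U))) s"
  proof (rule continuous_on_closed_Un[OF cl])
    show "continuous_on (P \<union> U) s"
      by (rule continuous_on_eq[OF continuous_on_const[of _ "-1"]]) (auto simp: s_def)
    show "continuous_on (Q \<union> (A - U)) s"
      using dis by (intro continuous_on_eq[OF continuous_on_const[of _ 1]]) (auto simp: s_def)
  qed
  moreover have "closedin (top_of_set K) ((P \<union> U) \<union> (Q \<union> (A - U)))"
    using cl sub UA by (intro closed_subset) auto
  ultimately obtain f where f: "continuous_on K f" "\<And>x. x \<in> (P \<union> U) \<union> (Q \<union> (A - U)) \<Longrightarrow> f x = s x"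
    by (rule Tietze[where B = 1]) (auto simp: s_def)
  show ?thesis
  proof (rule that[OF f(1)])
    show "f x = 1" if "x \<in> Q" for x using f(2)[of x] that dis by (auto simp: s_def)
    show "f x \<noteq> 0" if "x \<in> A" for x
    proof -
      have "f x = s x" using that by (intro f(2)) blast
      then show ?thesis by (simp add: s_def)
    qed
  qed (use f(2) in \<open>auto simp: s_def\<close>)
qed

section \<open>The inductive construction and the contradiction\<close>

theorem theorem1:
  fixes n :: nat and A :: "nat \<Rightarrow> (nat \<Rightarrow> real) set"
  assumes closed_A: "\<And>i. i \<in> {1..n} \<Longrightarrow> closedin (unit_cube n) (A i)"
    and cover: "(\<Union>i\<in>{1..n}. A i) = topspace (unit_cube n)"
  shows "\<exists>i\<in>{1..n}. \<forall>Z.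
           closedin (unit_cube n) Z \<and>
           covering_dim_le (subtopology (unit_cube n) Z) (int i - 2) \<longrightarrow>
           (\<exists>C \<in> connected_components_of (subtopology (unit_cube n) (A i - Z)).
              C \<inter> cube_face_minus n i \<noteq> {} \<and> C \<inter> cube_face_plus n i \<noteq> {})"
proof (rule ccontr)
  assume neg: "\<not> ?thesis"
  define K where "K = ({1..n} \<rightarrow>\<^sub>E {0..1::real})"
  have K: "compact K" unfolding K_def by (rule compact_unit_cube)
  have cube: "unit_cube n = top_of_set K" by (simp add: K_def unit_cube_eq)
  have clsd: "compact S \<and> S \<subseteq> K" if "closedin (top_of_set K) S" for S
    using K that closedin_compact closedin_subset by fastforce
  have face: "closedin (top_of_set K) {z \<in> K. z j = t}" for j t
    by (intro continuous_closedin_preimage_constant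
        continuous_on_subset[OF continuous_on_product_coordinates]) auto
  have "\<forall>i\<in>{1..n}. \<exists>Z. closedin (top_of_set K) Z \<and> covering_dim_le (subtopology (top_of_set K) Z) (int i - 2) \<and>
      (\<forall>C \<in> connected_components_of (subtopology (top_of_set K) (A i - Z)).
         C \<inter> cube_face_minus n i = {} \<or> C \<inter> cube_face_plus n i = {})"
    using neg[unfolded cube] by (simp only: bex_simps ball_simps not_all not_imp conj_assoc de_Morgan_conj not_not)
  then obtain Z where Z: "\<And>i. i \<in> {1..n} \<Longrightarrow> closedin (top_of_set K) (Z i)"
    and dimZ: "\<And>i. i \<in> {1..n} \<Longrightarrow> covering_dim_le (subtopology (top_of_set K) (Z i)) (int i - 2)"
    and comp: "\<And>i C. \<lbrakk>i \<in> {1..n}; C \<in> connected_components_of (subtopology (top_of_set K) (A i - Z i))\<rbrakk> \<Longrightarrow>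
         C \<inter> cube_face_minus n i = {} \<or> C \<inter> cube_face_plus n i = {}"
    by metis
  have cA: "compact (A i)" "A i \<subseteq> K" if "i \<in> {1..n}" for i
    using closed_A[OF that] clsd by (auto simp: cube)
  \<comment> \<open>One margin \<open>e\<close> quantifies both the face conditions and the absence
    of common zeros, so that all of them survive a perturbation smaller than
    \<open>e\<close>.\<close>
  define good where "good i f e \<longleftrightarrow> 0 < e \<and> (\<forall>j\<in>{1..i}. continuous_on K (f j)) \<and>
      (\<forall>j\<in>{1..i}. \<forall>z\<in>K. z j = 0 \<longrightarrow> f j z \<le> -e) \<and>
      (\<forall>j\<in>{1..i}. \<forall>z\<in>K. z j = 1 \<longrightarrow> e \<le> f j z) \<and>
      (\<forall>k\<in>{1..i}. \<forall>x\<in>A k. \<exists>j\<in>{1..i}. e \<le> \<bar>f j x\<bar>)"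
    for i and f :: "nat \<Rightarrow> (nat \<Rightarrow> real) \<Rightarrow> real" and e :: real
  have main: "\<exists>f e. good i f e" if "i \<le> n" for i
    using that
  proof (induction i)
    case 0
    show ?case by (auto simp: good_def gt_ex)
  next
    case (Suc i)
    then obtain f e where "good i f e"
      by (auto simp: Suc_le_eq dest: less_imp_le)
    then have e: "0 < e" and cf: "\<And>j. j \<in> {1..i} \<Longrightarrow> continuous_on K (f j)"
      and fm: "\<And>j z. \<lbrakk>j \<in> {1..i}; z \<in> K; z j = 0\<rbrakk> \<Longrightarrow> f j z \<le> -e"
      and fp: "\<And>j z. \<lbrakk>j \<in> {1..i}; z \<in> K; z j = 1\<rbrakk> \<Longrightarrow> e \<le> f j z"
      and fA: "\<And>k x. \<lbrakk>k \<in> {1..i}; x \<in> A k\<rbrakk> \<Longrightarrow> \<exists>j\<in>{1..i}. e \<le> \<bar>f j x\<bar>"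
      unfolding good_def by blast+
    define I where "I = Suc i"
    have I: "I \<in> {1..n}" using Suc.prems by (simp add: I_def)
    have ZI: "compact (Z I)" "Z I \<subseteq> K" using Z[OF I] clsd by auto
    have "subtopology (top_of_set K) (Z I) = top_of_set (Z I)"
      using ZI(2) by (simp add: subtopology_subtopology inf_absorb2)
    \<comment> \<open>Here \<open>int I - 2 = int i - 1\<close>: the dimension bound is one below
      the number of functions already built, as the perturbation lemma demands.\<close>
    then have dim: "covering_dim_le (top_of_set (Z I)) (int i - 1)"
      using dimZ[OF I] by (simp add: I_def)
    have "0 < e/2" using e by simp
    then obtain g where cg: "\<And>j. j \<in> {1..i} \<Longrightarrow> continuous_on K (g j)"
      and gf: "\<And>j x. \<lbrakk>j \<in> {1..i}; x \<in> K\<rbrakk> \<Longrightarrow> \<bar>g j x - f j x\<bar> \<le> e/2"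
      and gZ: "\<And>x. x \<in> Z I \<Longrightarrow> \<exists>j\<in>{1..i}. g j x \<noteq> 0"
      using zero_avoiding_perturbation[where f = f, OF ZI dim cf] by blast
    \<comment> \<open>The common zeros of the \<open>g j\<close> in \<open>A I\<close>; for
      \<open>i = 0\<close> this is all of \<open>A I\<close>, and \<open>gZ\<close> then says that
      \<open>Z I\<close> is empty. Compactness of \<open>B\<close> permits the separation, whereas
      \<open>A I - Z I\<close> need not be compact.\<close>
    define B where "B = (\<Inter>j\<in>{1..i}. {x \<in> K. g j x = 0}) \<inter> A I"
    have "closed {x \<in> K. g j x = 0}" if "j \<in> {1..i}" for j
      using continuous_closedin_preimage_constant[OF cg[OF that]] clsd compact_imp_closed by blast
    then have cB: "compact B"
      unfolding B_def using cA[OF I] by (intro closed_Int_compact closed_INT) auto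
    have BA: "B \<subseteq> A I - Z I" using gZ by (auto simp: B_def)
    have BK: "B \<subseteq> K" using BA cA[OF I] by auto
    have faces: "cube_face_minus n I = {z \<in> K. z I = 0}" "cube_face_plus n I = {z \<in> K. z I = 1}"
      by (auto simp: cube_face_minus_def cube_face_plus_def cube)
    \<comment> \<open>A nonempty connected subset of \<open>B\<close> lies in one component of
      \<open>A I - Z I\<close>, which by assumption misses one of the two faces.\<close>
    have con: "C \<inter> {z \<in> K. z I = 0} = {} \<or> C \<inter> {z \<in> K. z I = 1} = {}" if C: "connected C" "C \<subseteq> B" for C
    proof (cases "C = {}")
      case False
      have "connectedin (subtopology (top_of_set K) (A I - Z I)) C"
        using C BA BK by (auto simp: connectedin_subtopology)
      moreover have "subtopology (top_of_set K) (A I - Z I) \<noteq> trivial_topology"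
        using False C BA BK by (auto simp flip: null_topspace_iff_trivial)
      ultimately obtain D where "D \<in> connected_components_of (subtopology (top_of_set K) (A I - Z I))" "C \<subseteq> D"
        using exists_connected_component_of_superset by metis
      then show ?thesis using comp[OF I] unfolding faces by blast
    qed auto
    have cl: "closed {z \<in> K. z I = t}" for t
      using clsd[OF face] compact_imp_closed by blast
    have disj: "{z \<in> K. z I = 0} \<inter> {z \<in> K. z I = 1} = {}" and sub: "{z \<in> K. z I = t} \<subseteq> K" for t
      by auto
    obtain u :: "(nat \<Rightarrow> real) \<Rightarrow> real" where cu: "continuous_on K u" and um: "\<And>x. x \<in> {z \<in> K. z I = 0} \<Longrightarrow> u x = -1"
      and up: "\<And>x. x \<in> {z \<in> K. z I = 1} \<Longrightarrow> u x = 1" and uB: "\<And>x. x \<in> B \<Longrightarrow> u x \<noteq> 0"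
      using separating_function[OF cB cl cl disj BK sub sub con] by blast
    define h where "h = g(I := u)"
    have hg: "h j = g j" if "j \<in> {1..i}" for j using that by (auto simp: h_def I_def)
    have hI: "h I = u" by (simp add: h_def)
    have Icases: "j \<in> {1..i} \<or> j = I" if "j \<in> {1..I}" for j using that by (auto simp: I_def)
    have iI: "{1..i} \<subseteq> {1..I}" "I \<in> {1..I}" by (auto simp: I_def)
    have ch: "continuous_on K (h j)" if "j \<in> {1..I}" for j
      using Icases[OF that] cg cu hg hI by auto
    have "0 < (\<Sum>j\<in>{1..I}. \<bar>h j x\<bar>)" if x: "x \<in> A I" for x
    proof -
      have "\<exists>j\<in>{1..I}. h j x \<noteq> 0"
      proof (cases "x \<in> B")
        case True
        then show ?thesis using uB hI iI by metis
      next
        case False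
        then obtain j where "j \<in> {1..i}" "g j x \<noteq> 0" using x cA[OF I] by (auto simp: B_def)
        then show ?thesis using hg iI by (metis subsetD)
      qed
      then show ?thesis by (auto intro: sum_pos2)
    qed
    moreover have "continuous_on (A I) (\<lambda>x. \<Sum>j\<in>{1..I}. \<bar>h j x\<bar>)"
      using cA[OF I] ch by (intro continuous_on_sum continuous_on_rabs) (auto intro: continuous_on_subset)
    ultimately obtain c where c: "0 < c" "\<And>x. x \<in> A I \<Longrightarrow> c \<le> (\<Sum>j\<in>{1..I}. \<bar>h j x\<bar>)"
      using compact_pos_lower_bound[OF cA(1)[OF I], of "\<lambda>x. \<Sum>j\<in>{1..I}. \<bar>h j x\<bar>"] by blast
    \<comment> \<open>The three bounds are the old margin after the perturbation, the values -1 and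
      1 of \<open>u\<close> on the new faces, and the size that some
      \<open>\<bar>h j x\<bar>\<close> must have on \<open>A I\<close> because the sum of these
      \<open>I\<close> terms is at least \<open>c\<close>.\<close>
    define e' where "e' = min (e/2) (min 1 (c / real I))"
    have e': "0 < e'" using e c(1) by (simp add: e'_def I_def)
    have e'_le: "e' \<le> e/2" "e' \<le> 1" "e' \<le> c / real I" unfolding e'_def by linarith+
    have hm: "h j z \<le> -e'" if "j \<in> {1..I}" "z \<in> K" "z j = 0" for j z
      using Icases[OF that(1)]
    proof
      assume j: "j \<in> {1..i}"
      show ?thesis using fm[OF j that(2,3)] gf[OF j that(2)] e'_le unfolding hg[OF j] by linarith
    qed (use that um e'_le hI in auto)
    have hp: "e' \<le> h j z" if "j \<in> {1..I}" "z \<in> K" "z j = 1" for j z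
      using Icases[OF that(1)]
    proof
      assume j: "j \<in> {1..i}"
      show ?thesis using fp[OF j that(2,3)] gf[OF j that(2)] e'_le unfolding hg[OF j] by linarith
    qed (use that up e'_le hI in auto)
    have hA: "\<exists>j\<in>{1..I}. e' \<le> \<bar>h j x\<bar>" if kI: "k \<in> {1..I}" and xA: "x \<in> A k" for k x
      using Icases[OF kI]
    proof
      assume k: "k \<in> {1..i}"
      then have "k \<in> {1..n}" using I by (auto simp: I_def)
      then have xK: "x \<in> K" using xA cA by blast
      obtain j where j: "j \<in> {1..i}" "e \<le> \<bar>f j x\<bar>" using fA[OF k xA] by blast
      have "e' \<le> \<bar>g j x\<bar>" using j(2) gf[OF j(1) xK] e'_le by linarith
      then show ?thesis using j(1) hg iI by (metis subsetD)
    next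
      assume k: "k = I"
      show ?thesis
      proof (rule ccontr)
        assume "\<not> ?thesis"
        then have "(\<Sum>j\<in>{1..I}. \<bar>h j x\<bar>) < (\<Sum>j\<in>{1..I}. c / real I)"
          using e'_le(3) iI(2) by (intro sum_strict_mono) force+
        also have "\<dots> = c" by (simp add: I_def)
        finally show False using c(2)[of x] xA k by simp
      qed
    qed
    show ?case
      unfolding I_def[symmetric] good_def
      using e' ch hm hp hA by (intro exI[of _ h] exI[of _ e']) blast
  qed
  from main[OF order_refl] obtain f e where "good n f e"
    by blast
  then have e: "0 < e"
      and f: "\<And>j. j \<in> {1..n} \<Longrightarrow> continuous_on K (f j)"
        "\<And>j z. \<lbrakk>j \<in> {1..n}; z \<in> K; z j = 0\<rbrakk> \<Longrightarrow> f j z \<le> -e"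
        "\<And>j z. \<lbrakk>j \<in> {1..n}; z \<in> K; z j = 1\<rbrakk> \<Longrightarrow> e \<le> f j z"
        "\<And>k x. \<lbrakk>k \<in> {1..n}; x \<in> A k\<rbrakk> \<Longrightarrow> \<exists>j\<in>{1..n}. e \<le> \<bar>f j x\<bar>"
    unfolding good_def by blast+
  have "f j z < 0" if "j \<in> {1..n}" "z \<in> K" "z j = 0" for j z
    using f(2)[OF that] e by linarith
  moreover have "0 < f j z" if "j \<in> {1..n}" "z \<in> K" "z j = 1" for j z
    using f(3)[OF that] e by linarith
  \<comment> \<open>The common zero lies in some \<open>A k\<close> by the covering hypothesis,
    where some \<open>f j\<close> has absolute value at least \<open>e\<close>.\<close>
  ultimately obtain z where z: "z \<in> K" "\<And>j. j \<in> {1..n} \<Longrightarrow> f j z = 0"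
    using poincare_miranda[of n f] f(1) unfolding K_def by blast
  then obtain k where "k \<in> {1..n}" "z \<in> A k"
    using cover by (auto simp: cube)
  with f(4) z(2) e show False by fastforce
qed

end
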